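(* Let $v\in C^\infty(\mathbb T^1)$ with $\int_0^1 v(x)\,dx=0$ and let $(m,n)\in\mathbb R^2$. Let $\lambda(m,n)$ be the unique number such that $$\sqrt{m^2+(n+u')^2}+m v(x)=\lambda(m,n)$$ has a periodic viscosity solution $u$, and let $\hat\lambda(m,n)$ be the unique number such that $$\sqrt{m^2+(n+u')^2}+\frac{m(n+u')v'(x)}{\sqrt{m^2+(n+u')^2}}+m v(x)=\hat\lambda(m,n)$$ has a periodic viscosity solution $u$. Then $$\lambda(m,n)\ge\hat\lambda(m,n).$$ Moreover, if $m\neq 0$ and $\lambda(m,n)>|m|+\max_{\mathbb T^1}(mv)$, then $\lambda(m,n)=\hat\lambda(m,n)$ holds if and only if $v'\equiv 0$.
   Context: $\mathbb T^1=\mathbb R/\mathbb Z$; functions on $\mathbb T^1$ are identified with $1$-periodic functions on $\mathbb R$. Viscosity solutions are in the usual sense for the first-order equation in the unknown $u:\mathbb R\to\mathbb R$, and "periodic" means $1$-periodic. Existence and uniqueness of the numbers $\lambda(m,n)$, $\hat\lambda(m,n)$ is the standard cell-problem result for coercive Hamiltonians. When $m=0$ the middle (strain) term in the second equation is understood to be identically $0$. These numbers are the flame speeds of the G-equation, without and with strain, for the shear flow $V(x,y)=(v(y),0)$. *)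

theory Defs
  imports "HOL-Analysis.Analysis"
begin

(* Functions on the circle R/Z are 1-periodic functions on the real line. *)
definition one_periodic :: "(real \<Rightarrow> real) \<Rightarrow> bool" where
  "one_periodic f \<longleftrightarrow> (\<forall>x. f (x + 1) = f x)"

definition smooth :: "(real \<Rightarrow> real) \<Rightarrow> bool" where
  "smooth f \<longleftrightarrow> (\<forall>k x. (deriv ^^ k) f field_differentiable (at x))"

definition local_max_at :: "(real \<Rightarrow> real) \<Rightarrow> real \<Rightarrow> bool" where
  "local_max_at f x \<longleftrightarrow> (\<forall>\<^sub>F y in nhds x. f y \<le> f x)"

definition local_min_at :: "(real \<Rightarrow> real) \<Rightarrow> real \<Rightarrow> bool" where
  "local_min_at f x \<longleftrightarrow> (\<forall>\<^sub>F y in nhds x. f x \<le> f y)"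

(* Viscosity sub- and supersolutions of H(x, u'(x)) = c, with the sign convention of
   H(x, u') - c = 0; test functions are C^1 on the whole line. *)
definition viscosity_subsolution :: "(real \<Rightarrow> real \<Rightarrow> real) \<Rightarrow> real \<Rightarrow> (real \<Rightarrow> real) \<Rightarrow> bool" where
  "viscosity_subsolution H c u \<longleftrightarrow>
     (\<forall>\<phi> x. \<phi> C1_differentiable_on UNIV \<and> local_max_at (\<lambda>y. u y - \<phi> y) x \<longrightarrow> H x (deriv \<phi> x) \<le> c)"

definition viscosity_supersolution :: "(real \<Rightarrow> real \<Rightarrow> real) \<Rightarrow> real \<Rightarrow> (real \<Rightarrow> real) \<Rightarrow> bool" where
  "viscosity_supersolution H c u \<longleftrightarrow>
     (\<forall>\<phi> x. \<phi> C1_differentiable_on UNIV \<and> local_min_at (\<lambda>y. u y - \<phi> y) x \<longrightarrow> c \<le> H x (deriv \<phi> x))"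

definition viscosity_solution :: "(real \<Rightarrow> real \<Rightarrow> real) \<Rightarrow> real \<Rightarrow> (real \<Rightarrow> real) \<Rightarrow> bool" where
  "viscosity_solution H c u \<longleftrightarrow>
     continuous_on UNIV u \<and> viscosity_subsolution H c u \<and> viscosity_supersolution H c u"

(* c solves the cell problem of H. For coercive Hamiltonians exactly one such c exists;
   a statement about every such c is a statement about that number. *)
definition cell_constant :: "(real \<Rightarrow> real \<Rightarrow> real) \<Rightarrow> real \<Rightarrow> bool" where
  "cell_constant H c \<longleftrightarrow> (\<exists>u. one_periodic u \<and> viscosity_solution H c u)"

definition ham :: "(real \<Rightarrow> real) \<Rightarrow> real \<Rightarrow> real \<Rightarrow> real \<Rightarrow> real \<Rightarrow> real" where
  "ham v m n x p = sqrt (m\<^sup>2 + (n + p)\<^sup>2) + m * v x"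

(* The strain term is 0 when m = 0, by convention. *)
definition ham_strain :: "(real \<Rightarrow> real) \<Rightarrow> real \<Rightarrow> real \<Rightarrow> real \<Rightarrow> real \<Rightarrow> real" where
  "ham_strain v m n x p =
     sqrt (m\<^sup>2 + (n + p)\<^sup>2)
     + (if m = 0 then 0 else m * (n + p) * deriv v x / sqrt (m\<^sup>2 + (n + p)\<^sup>2))
     + m * v x"

end

theory Submission
  imports Defs
begin

text \<open>By the Cauchy-Schwarz inequality \<open>m\<^sup>2 + p q \<le> sqrt (m\<^sup>2 + p\<^sup>2) * sqrt (m\<^sup>2 + q\<^sup>2)\<close>, applied to
  \<open>q = p - m v'\<close>, the strained Hamiltonian at \<open>p - m v'\<close> is at most the unstrained one at \<open>p\<close>.
  So \<open>u - m v\<close> is a subsolution of the strained equation whenever \<open>u\<close> solves the unstrained one, and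
  comparison gives the inequality. If \<open>lam > |m| + max (m v)\<close>, then the unstrained equation has a
  \<open>C\<^sup>1\<close> solution, with total slope \<open>n / |n| * sqrt ((lam - m v)\<^sup>2 - m\<^sup>2)\<close>. Unless \<open>v'\<close> vanishes
  identically, the defect in the Cauchy-Schwarz inequality leaves room to perturb it to a \<open>C\<^sup>1\<close> function
  whose strained Hamiltonian is everywhere below \<open>lam\<close>.\<close>

subsection \<open>Periodic functions\<close>

lemma one_periodic_add_int:
  assumes "one_periodic f"
  shows "f (x + of_int k) = f x"
proof -
  have nat: "f (y + real j) = f y" for y and j :: nat
  proof (induction j)
    case (Suc j)
    have "f (y + real (Suc j)) = f ((y + real j) + 1)" by (simp add: ac_simps)
    also have "\<dots> = f (y + real j)" using assms unfolding one_periodic_def by blast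
    finally show ?case using Suc by simp
  qed simp
  show ?thesis
  proof (cases "k \<ge> 0")
    case True
    then show ?thesis using nat[of x "nat k"] by simp
  next
    case False
    then show ?thesis using nat[of "x + of_int k" "nat (- k)"] by simp
  qed
qed

lemma one_periodic_frac:
  assumes "one_periodic f"
  shows "f (frac x) = f x"
  using one_periodic_add_int[OF assms, of x "- \<lfloor>x\<rfloor>"] by (simp add: frac_def)

lemma one_periodic_deriv:
  assumes "one_periodic f" and "\<And>x. (f has_real_derivative f' x) (at x)"
  shows "one_periodic f'"
  unfolding one_periodic_def
proof
  fix x
  have "((\<lambda>y. f (y + 1)) has_real_derivative f' (x + 1)) (at x)"
    using assms(2)[of "x + 1"] DERIV_shift by blast
  moreover have "(\<lambda>y. f (y + 1)) = f" using assms(1) by (auto simp: one_periodic_def)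
  ultimately show "f' (x + 1) = f' x" using assms(2) DERIV_unique by metis
qed

lemma one_periodic_attains_sup:
  assumes "one_periodic f" and "continuous_on UNIV f"
  obtains x where "\<And>y. f y \<le> f x"
proof -
  have "\<exists>x\<in>{0..1}. \<forall>y\<in>{0..1}. f y \<le> f x"
    by (rule continuous_attains_sup) (use assms(2) continuous_on_subset in auto)
  then obtain x where x: "\<forall>y\<in>{0..1}. f y \<le> f x" by blast
  have "f y \<le> f x" for y
    using x one_periodic_frac[OF assms(1), of y] frac_ge_0[of y] frac_lt_1[of y]
    by (metis atLeastAtMost_iff less_imp_le)
  then show ?thesis using that by blast
qed

lemma one_periodic_attains_inf:
  assumes "one_periodic f" and "continuous_on UNIV f"
  obtains x where "\<And>y. f x \<le> f y"
proof -
  have "one_periodic (\<lambda>x. - f x)" using assms(1) by (simp add: one_periodic_def)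
  moreover have "continuous_on UNIV (\<lambda>x. - f x)" by (intro continuous_intros assms)
  ultimately obtain x where "\<And>y. - f y \<le> - f x" by (rule one_periodic_attains_sup) blast
  then show ?thesis using that by auto
qed

lemma one_periodic_bounded:
  assumes "one_periodic f" and "continuous_on UNIV f"
  obtains M where "M > 0" and "\<And>x. \<bar>f x\<bar> \<le> M"
proof -
  have "one_periodic (\<lambda>x. \<bar>f x\<bar>)" using assms(1) by (simp add: one_periodic_def)
  moreover have "continuous_on UNIV (\<lambda>x. \<bar>f x\<bar>)" by (intro continuous_intros assms)
  ultimately obtain x where x: "\<And>y. \<bar>f y\<bar> \<le> \<bar>f x\<bar>" by (rule one_periodic_attains_sup) blast
  \<comment> \<open>The added 1 makes the bound positive even for \<open>f = 0\<close>, so that it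
    can serve as a divisor.\<close>
  show ?thesis by (rule that[of "\<bar>f x\<bar> + 1"]) (use x in \<open>auto simp: add_increasing2\<close>)
qed

text \<open>\<open>F (x + 1) - F x\<close> has derivative \<open>f (x + 1) - f x = 0\<close>, so it
  is constant and equals the vanishing integral over one period. Mean-zero slopes thus yield
  periodic test functions.\<close>

lemma one_periodic_antiderivative:
  assumes "one_periodic f" and "continuous_on UNIV f" and "integral {0..1} f = 0"
  obtains F where "one_periodic F" and "\<And>x. (F has_real_derivative f x) (at x)"
proof -
  have "\<exists>F. \<forall>x :: real. -\<infinity> < ereal x \<longrightarrow> ereal x < \<infinity> \<longrightarrow> (F has_vector_derivative f x) (at x)"
    by (rule einterval_antiderivative)
       (use assms(2) in \<open>auto simp: continuous_on_eq_continuous_at\<close>)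
  then obtain F where F: "\<And>x. (F has_real_derivative f x) (at x)"
    by (auto simp: has_real_derivative_iff_has_vector_derivative)
  have "((\<lambda>y. F (y + 1) - F y) has_real_derivative 0) (at x)" for x
  proof -
    have "((\<lambda>y. F (y + 1)) has_real_derivative f (x + 1)) (at x)"
      using F[of "x + 1"] DERIV_shift by blast
    then have "((\<lambda>y. F (y + 1) - F y) has_real_derivative (f (x + 1) - f x)) (at x)"
      by (intro derivative_intros F)
    then show ?thesis using assms(1) by (simp add: one_periodic_def)
  qed
  then have const: "F (x + 1) - F x = F (0 + 1) - F 0" for x
    using DERIV_isconst_all[of "\<lambda>y. F (y + 1) - F y" x 0] by blast
  have "(f has_integral (F 1 - F 0)) {0..1}"
    by (rule fundamental_theorem_of_calculus)
       (use F in \<open>auto simp: has_real_derivative_iff_has_vector_derivative[symmetric]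
          intro: has_field_derivative_at_within\<close>)
  then have "F 1 - F 0 = 0" using assms(3) by (simp add: integral_unique)
  with const have "one_periodic F" unfolding one_periodic_def by (metis add_0 eq_iff_diff_eq_0)
  then show ?thesis using F that by blast
qed

subsection \<open>Viscosity solutions on the circle\<close>

lemma C1_differentiable_on_UNIV_I:
  assumes "\<And>x. (f has_real_derivative f' x) (at x)" and "continuous_on UNIV f'"
  shows "f C1_differentiable_on UNIV"
  using assms unfolding C1_differentiable_on_def has_real_derivative_iff_has_vector_derivative
  by blast

lemma viscosity_subsolutionD:
  assumes "viscosity_subsolution H c u"
    and "\<And>x. (\<phi> has_real_derivative \<phi>' x) (at x)" and "continuous_on UNIV \<phi>'"
    and "\<And>y. u y - \<phi> y \<le> u x - \<phi> x"
  shows "H x (\<phi>' x) \<le> c"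
proof -
  have "\<phi> C1_differentiable_on UNIV" using C1_differentiable_on_UNIV_I assms(2,3) by blast
  moreover have "local_max_at (\<lambda>y. u y - \<phi> y) x"
    unfolding local_max_at_def using assms(4) by simp
  ultimately have "H x (deriv \<phi> x) \<le> c"
    using assms(1) unfolding viscosity_subsolution_def by blast
  then show ?thesis using DERIV_imp_deriv[OF assms(2)] by simp
qed

lemma viscosity_supersolutionD:
  assumes "viscosity_supersolution H c u"
    and "\<And>x. (\<phi> has_real_derivative \<phi>' x) (at x)" and "continuous_on UNIV \<phi>'"
    and "\<And>y. u x - \<phi> x \<le> u y - \<phi> y"
  shows "c \<le> H x (\<phi>' x)"
proof -
  have "\<phi> C1_differentiable_on UNIV" using C1_differentiable_on_UNIV_I assms(2,3) by blast
  moreover have "local_min_at (\<lambda>y. u y - \<phi> y) x"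
    unfolding local_min_at_def using assms(4) by simp
  ultimately have "c \<le> H x (deriv \<phi> x)"
    using assms(1) unfolding viscosity_supersolution_def by blast
  then show ?thesis using DERIV_imp_deriv[OF assms(2)] by simp
qed

text \<open>For a periodic primitive \<open>F\<close> of \<open>q\<close>, the difference
  \<open>u - F\<close> attains a global maximum and minimum; there \<open>F\<close>, up to a
  constant, touches the solution \<open>u\<close> from above and from below with slope
  \<open>q\<close>. A trial slope thus bounds \<open>c\<close> without any knowledge of
  \<open>u\<close>.\<close>

lemma cell_constant_test:
  assumes "cell_constant H c" and "one_periodic q" and "continuous_on UNIV q"
    and "integral {0..1} q = 0"
  shows "(\<exists>x. H x (q x) \<le> c) \<and> (\<exists>x. c \<le> H x (q x))"
proof -
  obtain F where F: "one_periodic F" "\<And>x. (F has_real_derivative q x) (at x)"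
    using one_periodic_antiderivative assms(2-4) by blast
  obtain u where u: "one_periodic u" "viscosity_solution H c u"
    using assms(1) unfolding cell_constant_def by blast
  have "continuous_on UNIV F"
    using F(2) by (meson DERIV_isCont continuous_at_imp_continuous_on)
  then have cont: "continuous_on UNIV (\<lambda>x. u x - F x)"
    using u(2) by (intro continuous_intros) (auto simp: viscosity_solution_def)
  have per: "one_periodic (\<lambda>x. u x - F x)"
    using u(1) F(1) by (simp add: one_periodic_def)
  obtain x where "\<And>y. u y - F y \<le> u x - F x"
    using one_periodic_attains_sup[OF per cont] by blast
  then have "H x (q x) \<le> c"
    using u(2) F(2) assms(3) viscosity_subsolutionD unfolding viscosity_solution_def by blast
  moreover obtain z where "\<And>y. u z - F z \<le> u y - F y"
    using one_periodic_attains_inf[OF per cont] by blast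
  then have "c \<le> H z (q z)"
    using u(2) F(2) assms(3) viscosity_supersolutionD unfolding viscosity_solution_def by blast
  ultimately show ?thesis by blast
qed

section \<open>Comparison principle by doubling of variables\<close>

text \<open>For \<open>x\<close> in \<open>{0..1}\<close>, a point \<open>y\<close> outside
  \<open>{-1..2}\<close> costs a penalty of at least \<open>K\<close>, and
  \<open>2 * M - K \<le> - 2 * M\<close> is no better than the value at the origin. So the maximum
  over a compact rectangle is global in \<open>y\<close>; shifting both variables by the same
  integer makes it global in \<open>x\<close> too.\<close>

lemma doubling_maximum:
  fixes u w :: "real \<Rightarrow> real"
  assumes "one_periodic u" "continuous_on UNIV u" "one_periodic w" "continuous_on UNIV w"
    and u: "\<And>x. \<bar>u x\<bar> \<le> M" and w: "\<And>x. \<bar>w x\<bar> \<le> M" and K: "4 * M \<le> K" "0 \<le> K"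
  obtains x y where "x \<in> {0..1}" and "y \<in> {-1..2}"
    and "\<And>x' y'. u x' - w y' - K * (x' - y')\<^sup>2 \<le> u x - w y - K * (x - y)\<^sup>2"
proof -
  define D where "D = {0..1::real} \<times> {-1..2::real}"
  define P where "P = (\<lambda>z. u (fst z) - w (snd z) - K * (fst z - snd z)\<^sup>2)"
  have cu: "continuous_on D (\<lambda>z. u (fst z))" and cw: "continuous_on D (\<lambda>z. w (snd z))"
    by (rule continuous_on_compose2[OF assms(2)] continuous_on_compose2[OF assms(4)],
        auto intro!: continuous_intros)+
  have "continuous_on D P"
    unfolding P_def by (intro continuous_intros cu cw)
  moreover have "compact D" "D \<noteq> {}" by (auto simp: D_def intro: compact_Times)
  ultimately obtain z where z: "z \<in> D" "\<And>z'. z' \<in> D \<Longrightarrow> P z' \<le> P z"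
    using continuous_attains_sup by metis
  have bd: "P (x, y) \<le> P z" if "x \<in> {0..1}" for x y
  proof (cases "y \<in> {-1..2}")
    case True
    then show ?thesis using that z(2) by (simp add: D_def)
  next
    case False
    then have "1 \<le> \<bar>x - y\<bar>" using that by auto
    then have "1 \<le> (x - y)\<^sup>2" using one_le_power[of "\<bar>x - y\<bar>" 2] by simp
    then have "K * 1 \<le> K * (x - y)\<^sup>2" using K(2) by (rule mult_left_mono)
    moreover have "P (0, 0) \<le> P z" by (rule z(2)) (simp add: D_def)
    ultimately show ?thesis
      using u[of x] w[of y] u[of 0] w[of 0] K(1) unfolding P_def fst_conv snd_conv
      by (simp add: abs_le_iff)
  qed
  have "u x' - w y' - K * (x' - y')\<^sup>2 \<le> P z" for x' y'
  proof -
    have "u (frac x') = u x'" using one_periodic_frac assms(1) by blast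
    moreover have "w (y' - of_int \<lfloor>x'\<rfloor>) = w y'"
      using one_periodic_add_int[OF assms(3), of y' "- \<lfloor>x'\<rfloor>"] by simp
    moreover have "frac x' - (y' - of_int \<lfloor>x'\<rfloor>) = x' - y'" by (simp add: frac_def)
    moreover have "frac x' \<in> {0..1}" by (simp add: frac_lt_1 less_imp_le)
    ultimately show ?thesis using bd[of "frac x'" "y' - of_int \<lfloor>x'\<rfloor>"]
      by (simp only: P_def fst_conv snd_conv)
  qed
  then show ?thesis using that[of "fst z" "snd z"] z(1) by (auto simp: D_def P_def)
qed

text \<open>At a maximum of the doubled function both test functions have the same slope
  \<open>p\<close>. The subsolution inequality and coercivity bound \<open>p\<close>, so a large
  \<open>K\<close> forces \<open>x\<close> and \<open>y\<close> together, and uniform continuity of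
  \<open>H\<close> links \<open>d \<le> H y p\<close> to \<open>H x p \<le> c\<close>.\<close>

lemma comparison:
  assumes u: "one_periodic u" "continuous_on UNIV u" "viscosity_subsolution H c u"
    and w: "one_periodic w" "continuous_on UNIV w" "viscosity_supersolution H d w"
    and contH: "continuous_on UNIV (\<lambda>z. H (fst z) (snd z))"
    and coercive: "\<And>x p. H x p \<le> c \<Longrightarrow> \<bar>p\<bar> \<le> R"
  shows "d \<le> c"
proof (rule field_le_epsilon)
  fix e :: real assume "e > 0"
  define S where "S = {-1..2::real} \<times> {-R..R}"
  have "uniformly_continuous_on S (\<lambda>z. H (fst z) (snd z))"
    unfolding S_def
    by (rule compact_uniformly_continuous) (auto intro: continuous_on_subset[OF contH] compact_Times)
  then obtain r where r: "r > 0"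
    "\<And>z z'. z \<in> S \<Longrightarrow> z' \<in> S \<Longrightarrow> dist z' z < r
       \<Longrightarrow> dist (H (fst z') (snd z')) (H (fst z) (snd z)) < e"
    unfolding uniformly_continuous_on_def using \<open>e > 0\<close> by metis
  obtain M1 where M1: "\<And>x. \<bar>u x\<bar> \<le> M1" using one_periodic_bounded u(1,2) by blast
  obtain M2 where M2: "\<And>x. \<bar>w x\<bar> \<le> M2" using one_periodic_bounded w(1,2) by blast
  define M where "M = max M1 M2"
  \<comment> \<open>The first summand serves \<open>doubling_maximum\<close>; the second gives
    \<open>\<bar>R\<bar> < K * r\<close>, which turns
    \<open>2 * K * \<bar>x - y\<bar> = \<bar>p\<bar> \<le> R\<close> into
    \<open>\<bar>x - y\<bar> < r\<close>.\<close>
  define K where "K = \<bar>4 * M\<bar> + \<bar>R\<bar> / r + 1"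
  have K: "4 * M \<le> K" "0 < K" "\<bar>R\<bar> < K * r"
  proof -
    have "0 \<le> \<bar>R\<bar> / r" using r(1) by simp
    then show "4 * M \<le> K" "0 < K" unfolding K_def by linarith+
    have "\<bar>R\<bar> / r < K" unfolding K_def by linarith
    then show "\<bar>R\<bar> < K * r" using r(1) by (simp add: pos_divide_less_eq)
  qed
  obtain x y where xy: "x \<in> {0..1}" "y \<in> {-1..2}"
    and max: "\<And>x' y'. u x' - w y' - K * (x' - y')\<^sup>2 \<le> u x - w y - K * (x - y)\<^sup>2"
    using doubling_maximum[OF u(1,2) w(1,2), of M K] M1 M2 K
    unfolding M_def by (metis le_max_iff_disj less_imp_le)
  define p where "p = 2 * K * (x - y)"
  have "H x (2 * K * (x - y)) \<le> c"
    by (rule viscosity_subsolutionD[OF u(3), where \<phi> = "\<lambda>s. K * (s - y)\<^sup>2"])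
       (use max[of _ y] in \<open>auto intro!: derivative_eq_intros continuous_intros simp: algebra_simps\<close>)
  then have Hx: "H x p \<le> c" by (simp add: p_def)
  \<comment> \<open>With \<open>x\<close> frozen, \<open>w\<close> plus the penalty is minimal at
    \<open>y\<close>. The test function is minus the penalty, and its slope at \<open>y\<close> is
    again \<open>2 * K * (x - y)\<close>.\<close>
  have "d \<le> H y (2 * K * (x - y))"
    by (rule viscosity_supersolutionD[OF w(3), where \<phi> = "\<lambda>s. - K * (x - s)\<^sup>2"])
       (use max[of x] in \<open>auto intro!: derivative_eq_intros continuous_intros simp: algebra_simps\<close>)
  then have Hy: "d \<le> H y p" by (simp add: p_def)
  have pR: "\<bar>p\<bar> \<le> R" using coercive Hx by blast
  have "2 * K * \<bar>x - y\<bar> = \<bar>p\<bar>" using K(2) by (simp add: p_def abs_mult)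
  moreover have "0 \<le> K * \<bar>x - y\<bar>" using K(2) by simp
  ultimately have "K * \<bar>x - y\<bar> < K * r" using pR K(3) by linarith
  then have "\<bar>x - y\<bar> < r" using K(2) by simp
  then have "dist (y, p) (x, p) < r" by (simp add: dist_Pair_Pair dist_real_def)
  then have "dist (H y p) (H x p) < e"
    using r(2)[of "(x, p)" "(y, p)"] xy pR by (auto simp: S_def abs_le_iff)
  then show "d \<le> c + e" using Hx Hy by (simp add: dist_real_def)
qed

subsection \<open>The two Hamiltonians\<close>

lemma smooth_derivs:
  assumes "smooth v"
  shows "(v has_real_derivative deriv v x) (at x)" and "continuous_on UNIV (deriv v)"
    and "continuous_on UNIV v"
proof -
  have 0: "v field_differentiable (at x)" for x
    using assms[unfolded smooth_def, rule_format, of 0] by simp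
  then show "(v has_real_derivative deriv v x) (at x)"
    by (simp add: DERIV_deriv_iff_field_differentiable)
  show "continuous_on UNIV v"
    using 0 by (simp add: continuous_at_imp_continuous_on field_differentiable_imp_continuous_at)
  have "deriv v field_differentiable (at x)" for x
    using assms[unfolded smooth_def, rule_format, of 1] by simp
  then show "continuous_on UNIV (deriv v)"
    by (simp add: continuous_at_imp_continuous_on field_differentiable_imp_continuous_at)
qed

text \<open>The left side equals \<open>D / T\<close>, because \<open>q + m * b = p\<close>.
  Lagrange's identity gives \<open>(S * T)\<^sup>2 - D\<^sup>2 = m\<^sup>2 * (p - q)\<^sup>2 = m ^ 4
  * b\<^sup>2\<close>; factoring and using \<open>S * T + D \<le> 2 * (S * T)\<close> makes the
  Cauchy-Schwarz defect explicit.\<close>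

lemma strain_term_le:
  fixes m p b :: real
  assumes "m \<noteq> 0" and q: "q = p - m * b"
  shows "sqrt (m\<^sup>2 + q\<^sup>2) + m * q * b / sqrt (m\<^sup>2 + q\<^sup>2)
    \<le> sqrt (m\<^sup>2 + p\<^sup>2) - m ^ 4 * b\<^sup>2 / (2 * sqrt (m\<^sup>2 + p\<^sup>2) * (m\<^sup>2 + q\<^sup>2))"
proof -
  define S T D where "S = sqrt (m\<^sup>2 + p\<^sup>2)" and "T = sqrt (m\<^sup>2 + q\<^sup>2)" and "D = m\<^sup>2 + p * q"
  have pos: "0 < m\<^sup>2 + p\<^sup>2" "0 < m\<^sup>2 + q\<^sup>2" using assms(1) by (simp_all add: add_pos_nonneg)
  then have S: "S > 0" "S\<^sup>2 = m\<^sup>2 + p\<^sup>2" and T: "T > 0" "T\<^sup>2 = m\<^sup>2 + q\<^sup>2"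
    by (simp_all add: S_def T_def)
  have diff: "(S * T)\<^sup>2 - D\<^sup>2 = m ^ 4 * b\<^sup>2"
    unfolding power_mult_distrib S(2) T(2) by (simp add: D_def q power2_eq_square power4_eq_xxxx algebra_simps)
  have "0 \<le> m ^ 4 * b\<^sup>2" by simp
  then have "D\<^sup>2 \<le> (S * T)\<^sup>2" using diff by linarith
  then have DST: "D \<le> S * T" by (rule power2_le_imp_le) (use S(1) T(1) in simp)
  have "m ^ 4 * b\<^sup>2 = (S * T - D) * (S * T + D)"
    using diff by (simp add: power2_eq_square algebra_simps)
  also have "\<dots> \<le> (S * T - D) * (2 * (S * T))" using DST by (intro mult_left_mono) auto
  finally have key: "D \<le> S * T - m ^ 4 * b\<^sup>2 / (2 * (S * T))"
    using S(1) T(1) by (simp add: field_simps)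
  have "T + m * q * b / T = (T\<^sup>2 + m * q * b) / T" using T(1) by (simp add: field_simps power2_eq_square)
  also have "\<dots> = D / T" unfolding T(2) by (simp add: D_def q power2_eq_square algebra_simps)
  also have "\<dots> \<le> (S * T - m ^ 4 * b\<^sup>2 / (2 * (S * T))) / T"
    using key T(1) by (simp add: divide_right_mono)
  also have "\<dots> = S - m ^ 4 * b\<^sup>2 / (2 * S * T\<^sup>2)"
    using S(1) T(1) by (simp add: field_simps power2_eq_square)
  finally show ?thesis unfolding T(2) by (simp add: S_def T_def)
qed

lemma ham_strain_le_ham:
  "ham_strain v m n x (p - m * deriv v x) \<le> ham v m n x p"
proof (cases "m = 0")
  case False
  define q where "q = n + (p - m * deriv v x)"
  have "0 \<le> m ^ 4 * (deriv v x)\<^sup>2 / (2 * sqrt (m\<^sup>2 + (n + p)\<^sup>2) * (m\<^sup>2 + q\<^sup>2))"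
    by simp
  moreover have "q = n + p - m * deriv v x" by (simp add: q_def)
  note strain_term_le[OF False this]
  ultimately show ?thesis
    unfolding ham_def ham_strain_def if_not_P[OF False] q_def[symmetric] by linarith
qed (simp add: ham_def ham_strain_def)

text \<open>If \<open>\<phi>\<close> touches \<open>u - m v\<close> from above, then the C^1
  function \<open>\<phi> + m v\<close> touches \<open>u\<close> there. Its slope exceeds that of
  \<open>\<phi>\<close> by \<open>m v'\<close>, exactly the shift in
  \<open>ham_strain_le_ham\<close>.\<close>

lemma viscosity_subsolution_strain:
  assumes "smooth v" and "viscosity_subsolution (ham v m n) c u"
  shows "viscosity_subsolution (ham_strain v m n) c (\<lambda>x. u x - m * v x)"
  unfolding viscosity_subsolution_def
proof (intro allI impI)
  fix \<phi> x assume "\<phi> C1_differentiable_on UNIV \<and> local_max_at (\<lambda>y. u y - m * v y - \<phi> y) x"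
  then have \<phi>: "\<phi> C1_differentiable_on UNIV" and mx: "local_max_at (\<lambda>y. u y - m * v y - \<phi> y) x"
    by auto
  obtain \<phi>' where d: "\<And>x. (\<phi> has_real_derivative \<phi>' x) (at x)" and c: "continuous_on UNIV \<phi>'"
    using \<phi> unfolding C1_differentiable_on_def has_real_derivative_iff_has_vector_derivative by blast
  let ?\<psi> = "\<lambda>y. \<phi> y + m * v y"
  have d': "(?\<psi> has_real_derivative (\<phi>' y + m * deriv v y)) (at y)" for y
    by (intro derivative_intros d DERIV_cmult smooth_derivs assms(1))
  have "?\<psi> C1_differentiable_on UNIV"
    by (rule C1_differentiable_on_UNIV_I[OF d']) (intro continuous_intros c smooth_derivs assms(1))
  moreover have "local_max_at (\<lambda>y. u y - ?\<psi> y) x"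
    using mx by (simp add: local_max_at_def algebra_simps)
  ultimately have "ham v m n x (deriv ?\<psi> x) \<le> c"
    using assms(2) unfolding viscosity_subsolution_def by blast
  then have "ham v m n x (\<phi>' x + m * deriv v x) \<le> c" using DERIV_imp_deriv[OF d'] by simp
  then show "ham_strain v m n x (deriv \<phi> x) \<le> c"
    using ham_strain_le_ham[of v m n x "\<phi>' x + m * deriv v x"] DERIV_imp_deriv[OF d] by simp
qed

lemma continuous_ham_strain:
  assumes "smooth v"
  shows "continuous_on UNIV (\<lambda>z. ham_strain v m n (fst z) (snd z))"
proof -
  have v: "continuous_on UNIV (\<lambda>z::real \<times> real. v (fst z))"
    "continuous_on UNIV (\<lambda>z::real \<times> real. deriv v (fst z))"
    by (rule continuous_on_compose2[OF smooth_derivs(3)[OF assms]]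
             continuous_on_compose2[OF smooth_derivs(2)[OF assms]];
        auto intro!: continuous_intros)+
  show ?thesis
  proof (cases "m = 0")
    case True
    then show ?thesis by (simp add: ham_strain_def) (intro continuous_intros)
  next
    case False
    then have "m\<^sup>2 + (n + p)\<^sup>2 \<noteq> 0" for p by (simp add: sum_power2_eq_zero_iff)
    then have "sqrt (m\<^sup>2 + (n + p)\<^sup>2) \<noteq> 0" for p by simp
    then show ?thesis using False
      by (simp add: ham_strain_def del: real_sqrt_eq_0_iff) (intro continuous_intros v; simp)
  qed
qed

text \<open>The strain term is \<open>m v'\<close> times a ratio of modulus at most 1, so it stays
  bounded while the root is at least \<open>\<bar>n + p\<bar>\<close>.\<close>

lemma ham_strain_coercive:
  assumes "\<bar>v x\<bar> \<le> A" "\<bar>deriv v x\<bar> \<le> B" "ham_strain v m n x p \<le> c"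
  shows "\<bar>p\<bar> \<le> \<bar>c\<bar> + \<bar>m\<bar> * A + \<bar>m\<bar> * B + \<bar>n\<bar>"
proof -
  define s where "s = sqrt (m\<^sup>2 + (n + p)\<^sup>2)"
  define e where "e = (if m = 0 then 0 else m * (n + p) * deriv v x / s)"
  have s: "\<bar>n + p\<bar> \<le> s" unfolding s_def by (simp add: real_le_rsqrt)
  have "\<bar>m * v x\<bar> \<le> \<bar>m\<bar> * A" unfolding abs_mult using assms(1) by (simp add: mult_left_mono)
  moreover have "\<bar>e\<bar> \<le> \<bar>m\<bar> * B"
  proof (cases "m = 0")
    case False
    then have "s > 0" by (simp add: s_def add_pos_nonneg)
    have "\<bar>e\<bar> = \<bar>m\<bar> * (\<bar>deriv v x\<bar> * (\<bar>n + p\<bar> / s))"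
      using \<open>s > 0\<close> False by (simp add: e_def abs_mult)
    also have "\<dots> \<le> \<bar>m\<bar> * (B * 1)"
      using assms(2) s \<open>s > 0\<close> by (intro mult_left_mono mult_mono) auto
    finally show ?thesis by simp
  qed (simp add: e_def)
  moreover have "s + e + m * v x \<le> c"
    using assms(3) by (simp only: ham_strain_def s_def e_def)
  ultimately show ?thesis using s by linarith
qed

section \<open>Trial slopes of mean n and the strict inequality\<close>

text \<open>\<open>P\<close> stands for the total slope \<open>n + u'\<close>, whose mean is
  \<open>n\<close>; the 0 in \<open>ham v m 0\<close> reflects that \<open>n\<close> is absorbed
  into \<open>P\<close>.\<close>

lemma cell_constant_ham_test:
  assumes "cell_constant (ham v m n) c"
    and "one_periodic P" and "continuous_on UNIV P" and "integral {0..1} P = n"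
  shows "(\<exists>x. ham v m 0 x (P x) \<le> c) \<and> (\<exists>x. c \<le> ham v m 0 x (P x))"
proof -
  have "P integrable_on {0..1}"
    by (rule integrable_continuous_real) (use assms(3) continuous_on_subset in blast)
  then have "integral {0..1} (\<lambda>x. P x - n) = 0"
    using assms(4) by (subst integral_diff) (auto intro: integrable_const_ivl)
  then have "(\<exists>x. ham v m n x (P x - n) \<le> c) \<and> (\<exists>x. c \<le> ham v m n x (P x - n))"
    by (intro cell_constant_test assms)
       (use assms(2) in \<open>auto simp: one_periodic_def intro!: continuous_intros assms(3)\<close>)
  then show ?thesis by (simp add: ham_def)
qed

text \<open>Subtracting \<open>m v'\<close> preserves the mean, since \<open>v'\<close> integrates
  to 0 over a period. The trial slope then has the shifted form treated by
  \<open>strain_term_le\<close>.\<close>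

lemma cell_constant_strain_test:
  assumes "smooth v" "one_periodic v" and "cell_constant (ham_strain v m n) c"
    and "one_periodic P" and "continuous_on UNIV P" and "integral {0..1} P = n"
  shows "\<exists>x. c \<le> ham_strain v m 0 x (P x - m * deriv v x)"
proof -
  have "P integrable_on {0..1}"
    by (rule integrable_continuous_real) (use assms(5) continuous_on_subset in blast)
  moreover have "(deriv v has_integral v 1 - v 0) {0..1}"
    by (rule fundamental_theorem_of_calculus)
       (use smooth_derivs(1)[OF assms(1)] in \<open>auto simp: has_real_derivative_iff_has_vector_derivative[symmetric]
          intro: has_field_derivative_at_within\<close>)
  moreover have "v 1 - v 0 = 0" using assms(2) unfolding one_periodic_def by (metis add_0 diff_self)
  ultimately have "((\<lambda>x. P x - n - m * deriv v x) has_integral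
      n - n * (1 - 0) - m * 0) {0..1}"
    using assms(6) has_integral_const_real[of n 0 1]
    by (intro has_integral_diff has_integral_mult_right) (auto simp: has_integral_integral)
  then have "integral {0..1} (\<lambda>x. P x - n - m * deriv v x) = 0" by (simp add: integral_unique)
  moreover have "one_periodic (\<lambda>x. P x - n - m * deriv v x)"
    using assms(4) one_periodic_deriv[OF assms(2) smooth_derivs(1)[OF assms(1)]]
    by (simp add: one_periodic_def)
  moreover have "continuous_on UNIV (\<lambda>x. P x - n - m * deriv v x)"
    by (intro continuous_intros assms smooth_derivs)
  ultimately have "\<exists>x. c \<le> ham_strain v m n x (P x - n - m * deriv v x)"
    using cell_constant_test[OF assms(3)] by blast
  moreover have "ham_strain v m n x p = ham_strain v m 0 x (n + p)" for x p
    by (simp add: ham_strain_def)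
  moreover have "n + (P x - n - m * deriv v x) = P x - m * deriv v x" for x by simp
  ultimately show ?thesis by simp
qed

text \<open>Triangle inequality for the plane vectors \<open>(m, a)\<close> and
  \<open>(0, b)\<close>.\<close>

lemma sqrt_add_le:
  assumes "0 \<le> b"
  shows "sqrt (m\<^sup>2 + (a + b)\<^sup>2) \<le> sqrt (m\<^sup>2 + a\<^sup>2) + (b::real)"
  using real_sqrt_sum_squares_triangle_ineq[of m 0 a b] assms by simp

text \<open>\<open>g\<close> is the positive total slope solving the unstrained equation pointwise
  at level \<open>c\<close>. Testing with its multiple of mean \<open>n\<close> pins down that mean
  up to sign.\<close>

lemma cell_constant_ham_mean:
  assumes "smooth v" "one_periodic v" "cell_constant (ham v m n) c"
    and big: "\<And>x. \<bar>m\<bar> < c - m * v x"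
    and g_def: "g = (\<lambda>x. sqrt ((c - m * v x)\<^sup>2 - m\<^sup>2))"
  shows "\<bar>n\<bar> = integral {0..1} g" and "one_periodic g" and "continuous_on UNIV g"
    and "\<And>x. g x > 0" and "\<And>x. sqrt (m\<^sup>2 + (g x)\<^sup>2) = c - m * v x"
proof -
  show per: "one_periodic g" using assms(2) by (simp add: one_periodic_def g_def)
  show cont: "continuous_on UNIV g"
    unfolding g_def by (intro continuous_intros smooth_derivs assms)
  have lt: "m\<^sup>2 < (c - m * v x)\<^sup>2" for x
    using big[of x] by (metis abs_ge_zero power2_abs power_strict_mono zero_less_numeral)
  then show pos: "g x > 0" for x by (simp add: g_def)
  show sq: "sqrt (m\<^sup>2 + (g x)\<^sup>2) = c - m * v x" for x
    using lt[of x] big[of x] by (simp add: g_def)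
  define J where "J = integral {0..1} g"
  have "integral {0..1::real} (\<lambda>x. 0) < J"
    unfolding J_def
    by (rule integral_less_real) (use pos continuous_on_subset[OF cont] in auto)
  then have "J > 0" by simp
  \<comment> \<open>The ratio of \<open>\<bar>P\<bar>\<close> to \<open>g\<close> is the constant
    \<open>\<bar>n\<bar> / J\<close>. The test gives one point where it is at most 1 and one where
    it is at least 1, so it equals 1.\<close>
  define P where "P = (\<lambda>x. n / J * g x)"
  have "integral {0..1} P = n" using \<open>J > 0\<close> by (simp add: P_def J_def)
  moreover have "one_periodic P" using per by (simp add: one_periodic_def P_def)
  moreover have "continuous_on UNIV P" unfolding P_def by (intro continuous_intros cont)
  ultimately obtain x y where x: "ham v m 0 x (P x) \<le> c" and y: "c \<le> ham v m 0 y (P y)"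
    using cell_constant_ham_test[OF assms(3)] by blast
  have "sqrt (m\<^sup>2 + (P x)\<^sup>2) \<le> sqrt (m\<^sup>2 + (g x)\<^sup>2)"
    using x sq[of x] by (simp add: ham_def)
  then have "\<bar>P x\<bar> \<le> g x" using pos[of x] abs_le_square_iff[of "P x" "g x"] by simp
  then have "\<bar>n\<bar> \<le> J" using pos[of x] \<open>J > 0\<close> by (simp add: P_def abs_mult field_simps)
  moreover have "sqrt (m\<^sup>2 + (g y)\<^sup>2) \<le> sqrt (m\<^sup>2 + (P y)\<^sup>2)"
    using y sq[of y] by (simp add: ham_def)
  then have "g y \<le> \<bar>P y\<bar>" using pos[of y] abs_le_square_iff[of "g y" "P y"] by simp
  then have "J \<le> \<bar>n\<bar>" using pos[of y] \<open>J > 0\<close> by (simp add: P_def abs_mult field_simps)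
  ultimately show "\<bar>n\<bar> = integral {0..1} g" by (simp add: J_def)
qed

text \<open>Tilting the slope \<open>g\<close> of the corrector towards the region \<open>v' \<noteq> 0\<close>, while keeping its mean,
  pushes the unstrained Hamiltonian below \<open>lam\<close> where \<open>v' = 0\<close>; where \<open>v' \<noteq> 0\<close> the excess is
  absorbed by the Cauchy-Schwarz defect in \<open>strain_term_le\<close>.\<close>

lemma cell_constant_strain_less:
  assumes v: "smooth v" "one_periodic v" and lam: "cell_constant (ham v m n) lam"
    and hat: "cell_constant (ham_strain v m n) lamhat"
    and m: "m \<noteq> 0" and big: "\<And>x. \<bar>m\<bar> < lam - m * v x" and z: "deriv v z \<noteq> 0"
  shows "lamhat < lam"
proof -
  define g where "g = (\<lambda>x. sqrt ((lam - m * v x)\<^sup>2 - m\<^sup>2))"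
  note g = cell_constant_ham_mean[OF v lam big g_def]
  \<comment> \<open>The tilt uses the same factor \<open>v'\<^sup>2\<close> as the defect in
    \<open>strain_term_le\<close>, so excess and defect compare through constants alone.\<close>
  define w where "w = (\<lambda>x. (deriv v x)\<^sup>2)"
  have cv: "continuous_on UNIV (deriv v)" and pv: "one_periodic (deriv v)"
    using smooth_derivs[OF v(1)] one_periodic_deriv[OF v(2)] by auto
  have w0: "w x \<ge> 0" for x by (simp add: w_def)
  have cw: "continuous_on UNIV w" unfolding w_def by (intro continuous_intros cv)
  have pw: "one_periodic w" using pv by (simp add: w_def one_periodic_def)
  obtain G where G: "G > 0" "\<And>x. \<bar>g x\<bar> \<le> G" using one_periodic_bounded[OF g(2,3)] by blast
  obtain W where W: "W > 0" "\<And>x. \<bar>deriv v x\<bar> \<le> W" using one_periodic_bounded[OF pv cv] by blast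
  \<comment> \<open>\<open>B\<close> bounds both square roots at the trial slope and its shift by
    \<open>m v'\<close>, hence \<open>\<kappa> * w\<close> bounds the defect from below.\<close>
  define B where "B = \<bar>m\<bar> + G * (1 + W\<^sup>2) + \<bar>m\<bar> * W"
  have B: "B > 0" using m G(1) W(1) by (simp add: B_def add_pos_nonneg)
  define \<kappa> where "\<kappa> = m ^ 4 / (2 * B * B\<^sup>2)"
  have \<kappa>: "\<kappa> > 0" using m B by (simp add: \<kappa>_def)
  \<comment> \<open>\<open>\<theta> \<le> 1\<close> keeps \<open>h\<close> below
    \<open>G * (1 + W\<^sup>2)\<close>, as \<open>B\<close> presupposes;
    \<open>\<theta> * G \<le> \<kappa>\<close> lets the defect absorb the tilt.\<close>
  define \<theta> where "\<theta> = min 1 (\<kappa> / G)"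
  have \<theta>: "0 < \<theta>" "\<theta> \<le> 1" "\<theta> * G \<le> \<kappa>"
    using \<kappa> G(1) by (auto simp: \<theta>_def min_def field_simps)
  define h where "h = (\<lambda>x. g x * (1 + \<theta> * w x))"
  have ch: "continuous_on UNIV h" unfolding h_def by (intro continuous_intros g cw)
  define J where "J = integral {0..1} h"
  \<comment> \<open>The tilt adds a continuous nonnegative function that is nonzero at
    \<open>frac z\<close>, so the integral rises strictly above that of \<open>g\<close>, which is
    \<open>\<bar>n\<bar>\<close>.\<close>
  have "\<bar>n\<bar> < J"
  proof -
    have c: "continuous_on {0..1} (\<lambda>x. g x * (\<theta> * w x))"
      by (rule continuous_on_subset[OF _ subset_UNIV]) (intro continuous_intros g cw)
    have z': "frac z \<in> {0..1}" by (simp add: frac_lt_1 less_imp_le)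
    have "w (frac z) \<noteq> 0" using z one_periodic_frac[OF pw, of z] by (simp add: w_def)
    then have "g (frac z) * (\<theta> * w (frac z)) \<noteq> 0" using g(4)[of "frac z"] \<theta>(1) by simp
    then have "integral {0..1} (\<lambda>x. g x * (\<theta> * w x)) \<noteq> 0"
      using integral_eq_0_iff[OF c] z' g(4) \<theta>(1) w0 by (auto simp: less_imp_le)
    moreover have "0 \<le> integral {0..1} (\<lambda>x. g x * (\<theta> * w x))"
      by (rule integral_nonneg) (use c g(4) \<theta>(1) w0 in \<open>auto simp: less_imp_le intro: integrable_continuous_real\<close>)
    moreover have "J = integral {0..1} g + integral {0..1} (\<lambda>x. g x * (\<theta> * w x))"
      unfolding J_def h_def distrib_left mult_1_right
      by (rule integral_add)
         (use c continuous_on_subset[OF g(3)] in \<open>auto intro: integrable_continuous_real\<close>)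
    ultimately show ?thesis using g(1) by linarith
  qed
  \<comment> \<open>Restoring the mean \<open>n\<close> scales by a factor of modulus below 1. This
    is what yields strictness even where \<open>v' = 0\<close>.\<close>
  define P where "P = (\<lambda>x. n / J * h x)"
  have "integral {0..1} P = n" using \<open>\<bar>n\<bar> < J\<close> by (simp add: P_def J_def)
  moreover have "one_periodic P" using g(2) pw by (simp add: one_periodic_def P_def h_def)
  moreover have "continuous_on UNIV P" unfolding P_def by (intro continuous_intros ch)
  ultimately obtain x where "lamhat \<le> ham_strain v m 0 x (P x - m * deriv v x)"
    using cell_constant_strain_test[OF v hat] by blast
  also have "\<dots> < lam"
  proof -
    define q where "q = P x - m * deriv v x"
    define t where "t = \<bar>n\<bar> / J"
    have t: "0 \<le> t" "t < 1" using \<open>\<bar>n\<bar> < J\<close> by (auto simp: t_def)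
    have hx: "0 \<le> h x" using g(4)[of x] \<theta>(1) w0[of x] by (simp add: h_def)
    have absP: "\<bar>P x\<bar> = t * h x" using \<open>\<bar>n\<bar> < J\<close> hx by (simp add: P_def t_def abs_mult)
    have wW: "w x \<le> W\<^sup>2" unfolding w_def using W(2)[of x] by (metis abs_ge_zero power2_abs power_mono)
    have "\<theta> * w x \<le> 1 * W\<^sup>2" using \<theta> wW w0[of x] by (intro mult_mono) auto
    then have "h x \<le> G * (1 + W\<^sup>2)"
      unfolding h_def using G g(4)[of x] \<theta>(1) w0[of x] by (intro mult_mono) (auto simp: abs_le_iff)
    moreover have "t * h x \<le> 1 * h x" using t hx by (intro mult_right_mono) auto
    ultimately have Pb: "\<bar>P x\<bar> \<le> G * (1 + W\<^sup>2)" using absP by simp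
    have "\<bar>m * deriv v x\<bar> \<le> \<bar>m\<bar> * W" unfolding abs_mult using W(2) by (intro mult_left_mono) auto
    then have qb: "\<bar>q\<bar> \<le> G * (1 + W\<^sup>2) + \<bar>m\<bar> * W" using Pb unfolding q_def by linarith
    have "sqrt (m\<^sup>2 + (P x)\<^sup>2) \<le> \<bar>m\<bar> + \<bar>P x\<bar>" "sqrt (m\<^sup>2 + q\<^sup>2) \<le> \<bar>m\<bar> + \<bar>q\<bar>"
      by (rule sqrt_sum_squares_le_sum_abs)+
    moreover have "0 \<le> \<bar>m\<bar> * W" using W(1) by simp
    ultimately have SB: "sqrt (m\<^sup>2 + (P x)\<^sup>2) \<le> B" "sqrt (m\<^sup>2 + q\<^sup>2) \<le> B"
      using Pb qb unfolding B_def by linarith+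
    have pos: "0 < m\<^sup>2 + (P x)\<^sup>2" "0 < m\<^sup>2 + q\<^sup>2" using m by (simp_all add: add_pos_nonneg)
    have "m\<^sup>2 + q\<^sup>2 \<le> B\<^sup>2" using SB(2) by (simp add: sqrt_le_D)
    then have "2 * sqrt (m\<^sup>2 + (P x)\<^sup>2) * (m\<^sup>2 + q\<^sup>2) \<le> 2 * B * B\<^sup>2"
      using SB(1) pos B by (intro mult_mono) auto
    then have "m ^ 4 * w x / (2 * B * B\<^sup>2) \<le> m ^ 4 * w x / (2 * sqrt (m\<^sup>2 + (P x)\<^sup>2) * (m\<^sup>2 + q\<^sup>2))"
      using pos w0[of x] B by (intro divide_left_mono mult_pos_pos) auto
    then have defect: "\<kappa> * w x \<le> m ^ 4 * w x / (2 * sqrt (m\<^sup>2 + (P x)\<^sup>2) * (m\<^sup>2 + q\<^sup>2))"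
      by (simp add: \<kappa>_def)
    have "ham_strain v m 0 x q \<le> sqrt (m\<^sup>2 + (P x)\<^sup>2) - \<kappa> * w x + m * v x"
      using strain_term_le[OF m q_def] defect m by (simp add: ham_strain_def w_def)
    moreover have "sqrt (m\<^sup>2 + (P x)\<^sup>2) < lam - m * v x + \<kappa> * w x"
    proof -
      have split: "t * h x = t * g x + t * (\<theta> * w x * g x)" by (simp add: h_def algebra_simps)
      have e0: "0 \<le> \<theta> * w x * g x" using \<theta>(1) w0[of x] g(4)[of x] by simp
      have "sqrt (m\<^sup>2 + (P x)\<^sup>2) = sqrt (m\<^sup>2 + (t * g x + t * (\<theta> * w x * g x))\<^sup>2)"
        using absP split by (metis power2_abs)
      also have "\<dots> \<le> sqrt (m\<^sup>2 + (t * g x)\<^sup>2) + t * (\<theta> * w x * g x)"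
        by (rule sqrt_add_le) (use t e0 in simp)
      \<comment> \<open>Strictness comes from \<open>t * g x < g x\<close> alone; the tilt term is
        only estimated weakly.\<close>
      also have "\<dots> < sqrt (m\<^sup>2 + (g x)\<^sup>2) + 1 * (\<theta> * w x * g x)"
      proof (rule add_less_le_mono)
        have "t * g x < g x" "0 \<le> t * g x" using t g(4)[of x] by simp_all
        then have "(t * g x)\<^sup>2 < (g x)\<^sup>2" by (intro power_strict_mono) auto
        then show "sqrt (m\<^sup>2 + (t * g x)\<^sup>2) < sqrt (m\<^sup>2 + (g x)\<^sup>2)" by simp
        show "t * (\<theta> * w x * g x) \<le> 1 * (\<theta> * w x * g x)" using t e0 by (intro mult_right_mono) auto
      qed
      also have "\<theta> * w x * g x \<le> \<kappa> * w x"
      proof -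
        have "\<theta> * g x \<le> \<theta> * G" using \<theta>(1) G(2)[of x] by (intro mult_left_mono) auto
        then have "\<theta> * g x * w x \<le> \<kappa> * w x" using \<theta>(3) w0[of x] by (intro mult_right_mono) auto
        then show ?thesis by (simp add: ac_simps)
      qed
      finally show ?thesis using g(5)[of x] by simp
    qed
    ultimately show ?thesis unfolding q_def by linarith
  qed
  finally show ?thesis .
qed

theorem theorem2p2:
  fixes v :: "real \<Rightarrow> real" and m n lam lamhat :: real
  assumes "smooth v" and "one_periodic v" and "integral {0..1} v = 0"
    and "cell_constant (ham v m n) lam"
    and "cell_constant (ham_strain v m n) lamhat"
  shows "lam \<ge> lamhat \<and>
    (m \<noteq> 0 \<and> lam > \<bar>m\<bar> + (SUP x. m * v x) \<longrightarrow>
      (lam = lamhat \<longleftrightarrow> (\<forall>x. deriv v x = 0)))"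
proof -
  note d = smooth_derivs[OF assms(1)]
  obtain A where A: "\<And>x. \<bar>v x\<bar> \<le> A"
    using one_periodic_bounded[OF assms(2) d(3)] by blast
  obtain B where B: "\<And>x. \<bar>deriv v x\<bar> \<le> B"
    using one_periodic_bounded[OF one_periodic_deriv[OF assms(2) d(1)] d(2)] by blast
  obtain u where u: "one_periodic u" "viscosity_solution (ham v m n) lam u"
    using assms(4) unfolding cell_constant_def by blast
  obtain w where w: "one_periodic w" "viscosity_solution (ham_strain v m n) lamhat w"
    using assms(5) unfolding cell_constant_def by blast
  have comp: "d' \<le> c'"
    if "one_periodic f" "continuous_on UNIV f" "viscosity_subsolution (ham_strain v m n) c' f"
      "one_periodic g" "continuous_on UNIV g" "viscosity_supersolution (ham_strain v m n) d' g"
    for c' d' f g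
    by (rule comparison[OF that continuous_ham_strain[OF assms(1)] ham_strain_coercive[OF A B]])
  have le: "lamhat \<le> lam"
  proof (rule comp[OF _ _ viscosity_subsolution_strain[OF assms(1)]])
    show "one_periodic (\<lambda>x. u x - m * v x)"
      using u(1) assms(2) by (simp add: one_periodic_def)
    show "continuous_on UNIV (\<lambda>x. u x - m * v x)"
      using u(2) by (intro continuous_intros d) (simp add: viscosity_solution_def)
  qed (use u(2) w in \<open>auto simp: viscosity_solution_def\<close>)
  moreover have "lam = lamhat" if "\<forall>x. deriv v x = 0"
  proof -
    \<comment> \<open>The Hamiltonians now coincide, so \<open>w\<close> and \<open>u\<close> may
      exchange roles in the comparison.\<close>
    have "ham v m n = ham_strain v m n"
      using that by (auto simp: fun_eq_iff ham_def ham_strain_def)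
    then have "lam \<le> lamhat"
      using comp[OF w(1) _ _ u(1)] u(2) w(2) unfolding viscosity_solution_def by metis
    with le show ?thesis by simp
  qed
  moreover have "\<forall>x. deriv v x = 0"
    if "m \<noteq> 0" "lam > \<bar>m\<bar> + (SUP x. m * v x)" "lam = lamhat"
  proof (rule ccontr)
    assume "\<not> (\<forall>x. deriv v x = 0)"
    then obtain z where "deriv v z \<noteq> 0" by blast
    \<comment> \<open>A real \<open>SUP\<close> is known to dominate the values only once the range
      is bounded above.\<close>
    have "m * v x \<le> \<bar>m\<bar> * A" for x
      using mult_left_mono[OF A[of x], of "\<bar>m\<bar>"] abs_ge_self[of "m * v x"] by (simp add: abs_mult)
    then have "bdd_above (range (\<lambda>x. m * v x))" by (intro bdd_aboveI2[of _ _ "\<bar>m\<bar> * A"])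
    then have sup: "m * v x \<le> (SUP x. m * v x)" for x by (intro cSUP_upper) simp_all
    have "\<bar>m\<bar> < lam - m * v x" for x
      using that(2) sup[of x] by linarith
    then have "lamhat < lam"
      using cell_constant_strain_less assms that(1) \<open>deriv v z \<noteq> 0\<close> by blast
    then show False using that(3) by simp
  qed
  ultimately show ?thesis by blast
qed

end
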